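(* There is an absolute constant $K>0$ such that the following holds. Let $\mathcal{C}\subset\mathbb{R}^n$ be a compact convex set, $p\in[2,+\infty)$, let $x^*$ be a point of the relative interior of $\mathcal{C}$, let $D_p=\max_{x,y\in\mathcal{C}}\|y-x\|_p$, and let $r_p>0$ be the radius of an affine ball centered at $x^*$ and included in $\mathcal{C}$ with respect to the $\ell_p$-norm, i.e. $\{x\in\operatorname{aff}\mathcal{C}\mid\|x-x^*\|_p\leq r_p\}\subset\mathcal{C}$. Let $f(x)=\frac12\|x-x^*\|_p^2$ for $x\in\mathbb{R}^n$, and run the Frank-Wolfe algorithm on $\min_{x\in\mathcal{C}}f(x)$, started at an arbitrary vertex of $\mathcal{C}$, with the closed-loop step-size strategy. Then the algorithm produces an iterate $x\in\mathcal{C}$ satisfying $\|x-x^*\|_p\leq\epsilon$ whose cardinality is $\mathcal{O}\left(p(D_p/r_p)^2\ln(1/\epsilon)\right)$; precisely, there is $\epsilon_0\in(0,1)$ (which may depend on $\mathcal{C},x^*,p,r_p$) such that for every $\epsilon\in(0,\epsilon_0)$ the cardinality is at most $K\max\{1,p(D_p/r_p)^2\ln(1/\epsilon)\}$.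
   Context: $\|\cdot\|_p$ is the $\ell_p$-norm on $\mathbb{R}^n$ and $\langle\cdot,\cdot\rangle$ the Euclidean inner product. Vertices of $\mathcal{C}$ are its extreme points; $\operatorname{aff}\mathcal{C}$ is its affine hull. Frank-Wolfe algorithm (FW) for a differentiable function $f$ over $\mathcal{C}$: start at a vertex $x_0$ of $\mathcal{C}$; for $t=0,1,2,\ldots$ let $v_t$ be a vertex of $\mathcal{C}$ belonging to $\arg\min_{v\in\mathcal{C}}\langle v,\nabla f(x_t)\rangle$, and set $x_{t+1}=x_t+\gamma_t(v_t-x_t)$ with $\gamma_t\in[0,1]$. Here $f$ is differentiable, $\nabla f(x^* )=0$, and for $x\neq x^*$ the $i$-th entry of $\nabla f(x)$ is $\|x-x^*\|_p^{2-p}\operatorname{sign}([x-x^*]_i)|[x-x^*]_i|^{p-1}$. Closed-loop strategy: $\gamma_t=\min\left\{\frac{\langle x_t-v_t,\nabla f(x_t)\rangle}{(p-1)\|x_t-v_t\|_p^2},1\right\}$ (if $v_t=x_t$, the value of $\gamma_t$ is irrelevant). Each iterate $x_{t+1}=(1-\gamma_t)x_t+\gamma_tv_t$ comes with an explicit convex decomposition over $x_0,v_0,\ldots,v_t$. The cardinality of an iterate is the number of distinct vertices with positive weight in this decomposition. *)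

theory Defs
  imports "HOL-Analysis.Analysis" "HOL-Library.Function_Algebras"
begin

text \<open>
  The dimension \<open>n\<close> must be a term, not a type, since the constant of the theorem is uniform in
  \<open>n\<close>. Hence \<open>\<real>\<^sup>n\<close> is the set of sequences vanishing from index \<open>n\<close> on, inside the real vector
  space \<open>nat \<Rightarrow> real\<close> with pointwise operations. On this set the product topology of
  \<open>HOL-Analysis.Function_Topology\<close> induces the Euclidean topology, so that \<open>convex\<close>,
  \<open>affine hull\<close>, \<open>extreme_point_of\<close>, \<open>compact\<close> and \<open>rel_interior\<close> of the library have their
  usual meaning.
\<close>

instantiation "fun" :: (type, real_vector) real_vector
begin

definition scaleR_fun :: "real \<Rightarrow> ('a \<Rightarrow> 'b) \<Rightarrow> 'a \<Rightarrow> 'b"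
  where "scaleR_fun c f = (\<lambda>i. c *\<^sub>R f i)"

instance
  by standard (simp_all add: scaleR_fun_def fun_eq_iff scaleR_add_right scaleR_add_left)

end

lemma scaleR_fun_apply [simp]: "(c *\<^sub>R f) i = c *\<^sub>R f i"
  by (simp add: scaleR_fun_def)

definition Rn :: "nat \<Rightarrow> (nat \<Rightarrow> real) set"
  where "Rn n = {x. \<forall>i\<ge>n. x i = 0}"

definition inner_n :: "nat \<Rightarrow> (nat \<Rightarrow> real) \<Rightarrow> (nat \<Rightarrow> real) \<Rightarrow> real"
  where "inner_n n x y = (\<Sum>i<n. x i * y i)"

definition lp_norm :: "nat \<Rightarrow> real \<Rightarrow> (nat \<Rightarrow> real) \<Rightarrow> real"
  where "lp_norm n p x = (\<Sum>i<n. \<bar>x i\<bar> powr p) powr (1 / p)"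

text \<open>For nonempty compact \<open>C\<close> this supremum is a maximum.\<close>

definition lp_diameter :: "nat \<Rightarrow> real \<Rightarrow> (nat \<Rightarrow> real) set \<Rightarrow> real"
  where "lp_diameter n p C = (SUP (x, y)\<in>C \<times> C. lp_norm n p (y - x))"

definition gradient :: "nat \<Rightarrow> ((nat \<Rightarrow> real) \<Rightarrow> real) \<Rightarrow> (nat \<Rightarrow> real) \<Rightarrow> nat \<Rightarrow> real"
  where "gradient n f x = (\<lambda>i. if i < n then deriv (\<lambda>s. f (x(i := s))) (x i) else 0)"

definition lp_objective :: "nat \<Rightarrow> real \<Rightarrow> (nat \<Rightarrow> real) \<Rightarrow> (nat \<Rightarrow> real) \<Rightarrow> real"
  where "lp_objective n p xs x = 1 / 2 * (lp_norm n p (x - xs))\<^sup>2"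

text \<open>
  The argument \<open>\<gamma>\<close> is the sequence of step sizes, \<open>v\<close> the sequence of vertices returned by the
  linear minimization oracle, with arbitrary choice among minimizing vertices.
\<close>

definition frank_wolfe ::
  "nat \<Rightarrow> ((nat \<Rightarrow> real) \<Rightarrow> real) \<Rightarrow> (nat \<Rightarrow> real) set \<Rightarrow>
    (nat \<Rightarrow> nat \<Rightarrow> real) \<Rightarrow> (nat \<Rightarrow> nat \<Rightarrow> real) \<Rightarrow> (nat \<Rightarrow> real) \<Rightarrow> bool"
  where "frank_wolfe n f C x v \<gamma> \<longleftrightarrow>
    x 0 extreme_point_of C \<and>
    (\<forall>t. v t extreme_point_of C \<and>
         is_arg_min (\<lambda>u. inner_n n u (gradient n f (x t))) (\<lambda>u. u \<in> C) (v t) \<and>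
         \<gamma> t \<in> {0..1} \<and>
         x (Suc t) = x t + \<gamma> t *\<^sub>R (v t - x t))"

definition closed_loop ::
  "nat \<Rightarrow> real \<Rightarrow> ((nat \<Rightarrow> real) \<Rightarrow> real) \<Rightarrow>
    (nat \<Rightarrow> nat \<Rightarrow> real) \<Rightarrow> (nat \<Rightarrow> nat \<Rightarrow> real) \<Rightarrow> (nat \<Rightarrow> real) \<Rightarrow> bool"
  where "closed_loop n p f x v \<gamma> \<longleftrightarrow>
    (\<forall>t. v t \<noteq> x t \<longrightarrow>
      \<gamma> t = min (inner_n n (x t - v t) (gradient n f (x t)) /
                   ((p - 1) * (lp_norm n p (x t - v t))\<^sup>2)) 1)"

text \<open>
  \<open>fw_weight x0 v \<gamma> t u\<close> is the total weight of the vertex \<open>u\<close> in the convex decomposition of the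
  iterate \<open>t\<close> over \<open>x0, v 0, \<dots>, v (t - 1)\<close>; repeated vertices are merged.
\<close>

primrec fw_weight ::
  "(nat \<Rightarrow> real) \<Rightarrow> (nat \<Rightarrow> nat \<Rightarrow> real) \<Rightarrow> (nat \<Rightarrow> real) \<Rightarrow> nat \<Rightarrow> (nat \<Rightarrow> real) \<Rightarrow> real"
  where
    "fw_weight x0 v \<gamma> 0 = (\<lambda>u. if u = x0 then 1 else 0)"
  | "fw_weight x0 v \<gamma> (Suc t) =
      (\<lambda>u. (1 - \<gamma> t) * fw_weight x0 v \<gamma> t u + (if u = v t then \<gamma> t else 0))"

definition fw_cardinality ::
  "(nat \<Rightarrow> real) \<Rightarrow> (nat \<Rightarrow> nat \<Rightarrow> real) \<Rightarrow> (nat \<Rightarrow> real) \<Rightarrow> nat \<Rightarrow> nat"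
  where "fw_cardinality x0 v \<gamma> t = card {u. fw_weight x0 v \<gamma> t u > 0}"

text \<open>
  Since \<open>deriv\<close> is total, the following lemmas establish that the partial derivatives of the
  objective exist, and compute them.
\<close>

lemma has_real_derivative_abs_powr:
  fixes p a :: real
  assumes "2 \<le> p"
  shows "((\<lambda>s. \<bar>s - a\<bar> powr p) has_real_derivative
           p * (sgn (u - a) * \<bar>u - a\<bar> powr (p - 1))) (at u)"
proof (cases "u = a")
  case False
  have "((\<lambda>s. \<bar>s - a\<bar>) has_real_derivative sgn (u - a)) (at u)"
  proof (rule has_field_derivative_transform_within [of _ _ _ _ "\<bar>u - a\<bar>"])
    show "((\<lambda>s. sgn (u - a) * (s - a)) has_real_derivative sgn (u - a)) (at u)"
      by (auto intro!: derivative_eq_intros)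
    show "sgn (u - a) * (s - a) = \<bar>s - a\<bar>" if "dist s u < \<bar>u - a\<bar>" for s
      using that by (auto simp: sgn_if dist_real_def)
  qed (use False in auto)
  from DERIV_fun_powr [OF this, of p] False show ?thesis
    by (simp add: mult_ac)
next
  case True
  have "((\<lambda>h. (\<bar>h\<bar> powr p) / h) \<longlongrightarrow> 0) (at 0)"
  proof (rule Lim_null_comparison)
    have "\<bar>h\<bar> powr p / \<bar>h\<bar> \<le> \<bar>h\<bar>" if "h \<noteq> 0" "\<bar>h\<bar> < 1" for h :: real
    proof -
      have "\<bar>h\<bar> powr p \<le> \<bar>h\<bar> powr 2"
        using that assms by (intro powr_mono') auto
      also have "\<dots> = \<bar>h\<bar> * \<bar>h\<bar>"
        using that by (simp add: powr_numeral power2_eq_square)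
      finally show ?thesis
        using that by (simp add: divide_le_eq)
    qed
    then show "\<forall>\<^sub>F h in at (0::real). norm (\<bar>h\<bar> powr p / h) \<le> \<bar>h\<bar>"
      by (auto simp: eventually_at intro!: exI [of _ 1])
    show "((\<lambda>h::real. \<bar>h\<bar>) \<longlongrightarrow> 0) (at 0)"
      by (rule tendsto_rabs_zero) (rule tendsto_ident_at)
  qed
  with True show ?thesis
    by (simp add: DERIV_def)
qed

lemma lp_norm_sum_split:
  assumes "i < n"
  shows "lp_norm n p (x(i := s) - xs) =
    ((\<Sum>j\<in>{..<n} - {i}. \<bar>x j - xs j\<bar> powr p) + \<bar>s - xs i\<bar> powr p) powr (1 / p)"
proof -
  have "(\<Sum>j<n. \<bar>(x(i := s) - xs) j\<bar> powr p) =
      \<bar>s - xs i\<bar> powr p + (\<Sum>j\<in>{..<n} - {i}. \<bar>(x(i := s) - xs) j\<bar> powr p)"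
    using assms by (subst sum.remove [of _ i]) auto
  also have "(\<Sum>j\<in>{..<n} - {i}. \<bar>(x(i := s) - xs) j\<bar> powr p) =
      (\<Sum>j\<in>{..<n} - {i}. \<bar>x j - xs j\<bar> powr p)"
    by (rule sum.cong) auto
  finally show ?thesis
    by (simp add: lp_norm_def add.commute)
qed

lemma has_partial_derivative_lp_objective:
  assumes p: "2 \<le> p" and i: "i < n" and ne: "\<exists>j<n. x j \<noteq> xs j"
  shows "((\<lambda>s. lp_objective n p xs (x(i := s))) has_real_derivative
    lp_norm n p (x - xs) powr (2 - p) * sgn (x i - xs i) * \<bar>x i - xs i\<bar> powr (p - 1)) (at (x i))"
proof -
  define A where "A = (\<Sum>j\<in>{..<n} - {i}. \<bar>x j - xs j\<bar> powr p)"
  define S where "S = (\<lambda>s. A + \<bar>s - xs i\<bar> powr p)"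
  have S: "S (x i) = (\<Sum>j<n. \<bar>x j - xs j\<bar> powr p)"
    using i by (simp add: S_def A_def sum.remove [of "{..<n}" i])
  obtain k where k: "k < n" "x k \<noteq> xs k"
    using ne by blast
  have pos: "0 < S (x i)"
    unfolding S using k by (intro sum_pos2 [of _ k]) auto
  have nonneg: "0 \<le> S s" for s
    by (auto simp: S_def A_def intro!: add_nonneg_nonneg sum_nonneg)
  have eq: "(\<lambda>s. lp_objective n p xs (x(i := s))) = (\<lambda>s. 1 / 2 * S s powr (2 / p))"
  proof
    fix s
    have "(S s powr (1 / p))\<^sup>2 = S s powr (2 / p)"
      using nonneg [of s] by (cases "S s = 0") (simp_all add: powr_powr flip: powr_numeral)
    then show "lp_objective n p xs (x(i := s)) = 1 / 2 * S s powr (2 / p)"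
      using i by (simp add: lp_objective_def lp_norm_sum_split S_def A_def)
  qed
  have "(S has_real_derivative p * (sgn (x i - xs i) * \<bar>x i - xs i\<bar> powr (p - 1))) (at (x i))"
    unfolding S_def
    by (rule derivative_eq_intros has_real_derivative_abs_powr [OF p] refl | simp)+
  from DERIV_cmult [OF DERIV_fun_powr [OF this pos, of "2 / p"], of "1 / 2"]
  have "((\<lambda>s. 1 / 2 * S s powr (2 / p)) has_real_derivative
      S (x i) powr (2 / p - 1) * sgn (x i - xs i) * \<bar>x i - xs i\<bar> powr (p - 1)) (at (x i))"
    using p by (simp add: mult_ac)
  moreover have "S (x i) powr (2 / p - 1) = lp_norm n p (x - xs) powr (2 - p)"
    using p by (simp add: lp_norm_def S powr_powr field_simps)
  ultimately show ?thesis
    by (simp add: eq)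
qed

lemma has_partial_derivative_lp_objective_at_minimizer:
  assumes p: "2 \<le> p" and i: "i < n" and eq: "\<forall>j<n. x j = xs j"
  shows "((\<lambda>s. lp_objective n p xs (x(i := s))) has_real_derivative 0) (at (x i))"
proof -
  have "(\<Sum>j\<in>{..<n} - {i}. \<bar>x j - xs j\<bar> powr p) = 0"
    using eq by (intro sum.neutral) auto
  then have "(\<lambda>s. lp_objective n p xs (x(i := s))) = (\<lambda>s. 1 / 2 * (s - xs i)\<^sup>2)"
    using i p by (intro ext) (simp add: lp_objective_def lp_norm_sum_split powr_powr)
  moreover have "((\<lambda>s. 1 / 2 * (s - xs i)\<^sup>2) has_real_derivative 0) (at (x i))"
    using eq i by (auto intro!: derivative_eq_intros)
  ultimately show ?thesis
    by simp
qed

lemma gradient_lp_objective: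
  assumes "2 \<le> p" and "i < n"
  shows "gradient n (lp_objective n p xs) x i =
    (if \<forall>j<n. x j = xs j then 0
     else lp_norm n p (x - xs) powr (2 - p) * sgn (x i - xs i) * \<bar>x i - xs i\<bar> powr (p - 1))"
  using assms DERIV_imp_deriv [OF has_partial_derivative_lp_objective [of p i n x xs]]
    DERIV_imp_deriv [OF has_partial_derivative_lp_objective_at_minimizer [of p i n x xs]]
  by (auto simp: gradient_def)

end

theory Submission
  imports Defs
begin

text \<open>
  Write \<open>N x = \<parallel>x - xs\<parallel>\<^sub>p\<close>, so that the objective is \<open>f = N\<^sup>2 / 2\<close>. The closed-loop
  strategy converges linearly because the minimizer lies in the relative interior. Two facts are
  balanced against each other.

  First, \<open>f\<close> is \<open>(p - 1)\<close>-smooth with respect to \<open>\<parallel>\<cdot>\<parallel>\<^sub>p\<close> itself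
  (\<open>lp_objective_smooth\<close>): along a segment that avoids \<open>xs\<close> its second derivative is at most
  \<open>(p - 1) \<parallel>h\<parallel>\<^sub>p\<^sup>2\<close> by Hoelder's inequality. The closed-loop step minimizes, over \<open>[0, 1]\<close>, the
  quadratic upper bound that this gives, so a step with gap \<open>g = \<langle>x - v, \<nabla>f x\<rangle>\<close> decreases
  \<open>N\<^sup>2\<close> by at least \<open>g\<^sup>2 / ((p - 1) \<parallel>x - v\<parallel>\<^sub>p\<^sup>2)\<close>, unless the step is full.

  Second, the gap is at least \<open>N\<^sup>2 + r N\<close> (\<open>frank_wolfe_gap_ge\<close>): the point of \<open>C\<close> at distance
  \<open>r\<close> from \<open>xs\<close> in the direction opposite to \<open>x\<close> competes in the linear minimization, and
  \<open>\<langle>x - xs, \<nabla>f x\<rangle> = N\<^sup>2\<close>.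

  Together they contract \<open>N\<^sup>2\<close> by the factor \<open>1 - \<kappa>\<close> with \<open>\<kappa> = r\<^sup>2 / ((p - 1) D\<^sup>2)\<close> at every step
  (\<open>closed_loop_step_contraction\<close>), so about \<open>ln (1 / \<epsilon>) / \<kappa>\<close> steps suffice. Since a step adds
  at most one vertex to the decomposition, the number of steps bounds the cardinality.
\<close>

section \<open>The norm and the diameter\<close>

lemma lp_norm_nonneg: "0 \<le> lp_norm n p x"
  by (simp add: lp_norm_def)

lemma lp_norm_eq_0_iff: "lp_norm n p x = 0 \<longleftrightarrow> (\<forall>i<n. x i = 0)"
proof -
  have "(\<Sum>i<n. \<bar>x i\<bar> powr p) = 0 \<longleftrightarrow> (\<forall>i<n. x i = 0)"
    by (subst sum_nonneg_eq_0_iff) auto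
  then show ?thesis
    by (simp add: lp_norm_def)
qed

lemma lp_norm_powr_eq_sum:
  assumes "0 < p"
  shows "lp_norm n p x powr p = (\<Sum>i<n. \<bar>x i\<bar> powr p)"
  using assms by (simp add: lp_norm_def powr_powr sum_nonneg)

lemma lp_norm_scaleR:
  assumes "0 < p"
  shows "lp_norm n p (c *\<^sub>R x) = \<bar>c\<bar> * lp_norm n p x"
proof -
  have "(\<Sum>i<n. \<bar>(c *\<^sub>R x) i\<bar> powr p) = \<bar>c\<bar> powr p * (\<Sum>i<n. \<bar>x i\<bar> powr p)"
    by (simp add: sum_distrib_left abs_mult powr_mult)
  then show ?thesis
    using assms by (simp add: lp_norm_def powr_mult powr_powr sum_nonneg)
qed

lemma lp_norm_minus_commute: "lp_norm n p (x - y) = lp_norm n p (y - x)"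
  by (simp add: lp_norm_def abs_minus_commute)

lemma continuous_on_lp_norm_diff:
  assumes "0 < p"
  shows "continuous_on A (\<lambda>(x, y). lp_norm n p (y - x))"
proof -
  have powr: "continuous_on A (\<lambda>z. f z powr q)"
    if "continuous_on A f" "\<And>z. 0 \<le> f z" "0 < q" for f :: "_ \<Rightarrow> real" and q
    using that by (intro continuous_on_powr') auto
  have "continuous_on A (\<lambda>z. (\<Sum>i<n. \<bar>snd z i - fst z i\<bar> powr p) powr (1 / p))"
    using assms by (intro powr continuous_on_sum continuous_intros sum_nonneg
        continuous_on_product_then_coordinatewise) auto
  then show ?thesis
    by (simp add: lp_norm_def case_prod_unfold)
qed

text \<open>
  Compactness in the product topology bounds the distances, without which the supremum in the
  definition of the diameter would be meaningless.
\<close>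

lemma lp_norm_diff_le_diameter:
  assumes "0 < p" "compact C" "x \<in> C" "y \<in> C"
  shows "lp_norm n p (y - x) \<le> lp_diameter n p C"
proof -
  have "compact ((\<lambda>(x, y). lp_norm n p (y - x)) ` (C \<times> C))"
    using assms by (intro compact_continuous_image continuous_on_lp_norm_diff compact_Times)
  then have "bdd_above ((\<lambda>(x, y). lp_norm n p (y - x)) ` (C \<times> C))"
    by (intro bounded_imp_bdd_above compact_imp_bounded)
  then show ?thesis
    unfolding lp_diameter_def using assms by (intro cSUP_upper2 [where x = "(x, y)"]) auto
qed

section \<open>Smoothness of half the squared norm\<close>

text \<open>
  After both factors are scaled to have norm one, Young's inequality holds term by term and its
  right-hand sides add up to \<open>1 / p + 1 / q = 1\<close>.
\<close>

lemma Hoelder_inequality_sum: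
  fixes a b :: "'i \<Rightarrow> real"
  assumes "finite I" "1 < p" "1 < q" "1 / p + 1 / q = 1"
    and nonneg: "\<And>i. i \<in> I \<Longrightarrow> 0 \<le> a i" "\<And>i. i \<in> I \<Longrightarrow> 0 \<le> b i"
  shows "(\<Sum>i\<in>I. a i * b i) \<le> (\<Sum>i\<in>I. a i powr p) powr (1 / p) * (\<Sum>i\<in>I. b i powr q) powr (1 / q)"
proof -
  define A where "A = (\<Sum>i\<in>I. a i powr p)"
  define B where "B = (\<Sum>i\<in>I. b i powr q)"
  have "0 \<le> A" "0 \<le> B"
    by (simp_all add: A_def B_def sum_nonneg)
  show ?thesis
  proof (cases "A = 0 \<or> B = 0")
    case True
    then have "a i * b i = 0" if "i \<in> I" for i
      using that \<open>finite I\<close> by (auto simp: A_def B_def sum_nonneg_eq_0_iff)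
    then show ?thesis
      by (simp add: sum.neutral)
  next
    case False
    with \<open>0 \<le> A\<close> \<open>0 \<le> B\<close> have "0 < A" "0 < B"
      by auto
    define u w where "u = A powr (1 / p)" and "w = B powr (1 / q)"
    have pos: "0 < u" "0 < w" and pow: "u powr p = A" "w powr q = B"
      using \<open>0 < A\<close> \<open>0 < B\<close> assms(2,3) by (simp_all add: u_def w_def powr_powr)
    have "(\<Sum>i\<in>I. a i / u * (b i / w)) \<le> (\<Sum>i\<in>I. a i powr p / (A * p) + b i powr q / (B * q))"
    proof (rule sum_mono)
      fix i assume "i \<in> I"
      with nonneg have "0 \<le> a i" "0 \<le> b i"
        by auto
      with Youngs_inequality [OF assms(2-4), of "a i / u" "b i / w"] pos
      show "a i / u * (b i / w) \<le> a i powr p / (A * p) + b i powr q / (B * q)"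
        by (simp add: powr_divide pow)
    qed
    also have "\<dots> = A / (A * p) + B / (B * q)"
      by (simp add: sum.distrib A_def B_def flip: sum_divide_distrib)
    also have "\<dots> = 1"
      using \<open>0 < A\<close> \<open>0 < B\<close> assms(4) by simp
    finally have "(\<Sum>i\<in>I. a i * b i) / (u * w) \<le> 1"
      by (simp add: sum_divide_distrib)
    then show ?thesis
      using pos by (simp add: u_def w_def A_def B_def)
  qed
qed

text \<open>
  Hoelder's inequality with the conjugate exponents \<open>p / (p - 2)\<close> and \<open>p / 2\<close>. The left-hand side
  is the Hessian of \<open>\<Sum>\<bar>u i\<bar>\<^sup>p\<close> in the direction \<open>h\<close>, up to the factor \<open>p (p - 1)\<close>.
\<close>

lemma sum_powr_times_square_le:
  assumes "2 < p"
  shows "(\<Sum>i<n. (h i)\<^sup>2 * \<bar>u i\<bar> powr (p - 2)) \<le> lp_norm n p u powr (p - 2) * (lp_norm n p h)\<^sup>2"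
proof -
  have "(\<Sum>i<n. \<bar>u i\<bar> powr (p - 2) * (h i)\<^sup>2) \<le>
      (\<Sum>i<n. (\<bar>u i\<bar> powr (p - 2)) powr (p / (p - 2))) powr (1 / (p / (p - 2))) *
      (\<Sum>i<n. ((h i)\<^sup>2) powr (p / 2)) powr (1 / (p / 2))"
    using assms by (intro Hoelder_inequality_sum) (auto simp: field_simps)
  also have "(\<lambda>i. (\<bar>u i\<bar> powr (p - 2)) powr (p / (p - 2))) = (\<lambda>i. \<bar>u i\<bar> powr p)"
    using assms by (simp add: powr_powr)
  also have "(\<lambda>i. ((h i)\<^sup>2) powr (p / 2)) = (\<lambda>i. \<bar>h i\<bar> powr p)"
  proof
    fix i
    have "(h i)\<^sup>2 = \<bar>h i\<bar> powr 2"
      by simp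
    then show "((h i)\<^sup>2) powr (p / 2) = \<bar>h i\<bar> powr p"
      by (simp only: powr_powr) simp
  qed
  also have "(\<Sum>i<n. \<bar>u i\<bar> powr p) powr (1 / (p / (p - 2))) = lp_norm n p u powr (p - 2)"
    by (simp add: lp_norm_def powr_powr)
  also have "(\<Sum>i<n. \<bar>h i\<bar> powr p) powr (1 / (p / 2)) = (lp_norm n p h)\<^sup>2"
    by (simp add: lp_norm_def powr_powr flip: powr_numeral)
  finally show ?thesis
    by (simp add: mult.commute)
qed

text \<open>
  The bound \<open>1 < q\<close> makes the formula right at \<open>0\<close>. For \<open>q = 1\<close> it fails there because
  \<open>0 powr 0 = 0\<close>, and this is why the exponent \<open>p = 2\<close> is treated separately below.
\<close>

lemma has_real_derivative_sgn_powr: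
  fixes q u :: real
  assumes "1 < q"
  shows "((\<lambda>s. sgn s * \<bar>s\<bar> powr q) has_real_derivative q * \<bar>u\<bar> powr (q - 1)) (at u)"
proof (cases "u = 0")
  case False
  show ?thesis
  proof (rule has_field_derivative_transform_within [of _ _ _ _ "\<bar>u\<bar>"])
    have "((\<lambda>s. sgn u * s) has_real_derivative sgn u) (at u)"
      by (auto intro!: derivative_eq_intros)
    from DERIV_cmult [OF DERIV_fun_powr [OF this, of q], of "sgn u"] False
    show "((\<lambda>s. sgn u * (sgn u * s) powr q) has_real_derivative q * \<bar>u\<bar> powr (q - 1)) (at u)"
      by (auto simp: sgn_if split: if_splits)
    show "sgn u * (sgn u * s) powr q = sgn s * \<bar>s\<bar> powr q" if "dist s u < \<bar>u\<bar>" for s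
      using that by (auto simp: sgn_if dist_real_def)
  qed (use False in auto)
next
  case True
  have "((\<lambda>h::real. \<bar>h\<bar> powr (q - 1)) \<longlongrightarrow> \<bar>0\<bar> powr (q - 1)) (at 0)"
    using assms by (intro tendsto_powr' tendsto_intros) auto
  moreover have "\<bar>h\<bar> powr (q - 1) = (sgn h * \<bar>h\<bar> powr q) / h" if "h \<noteq> 0" for h :: real
    using that by (simp add: powr_diff sgn_if)
  ultimately have "((\<lambda>h::real. (sgn h * \<bar>h\<bar> powr q) / h) \<longlongrightarrow> 0) (at 0)"
    by (subst tendsto_cong [of _ "\<lambda>h. \<bar>h\<bar> powr (q - 1)"]) (auto simp: eventually_at_filter)
  with True show ?thesis
    by (simp add: DERIV_def)
qed

text \<open>
  At the minimizer, where the gradient is given by a separate clause, both sides vanish because of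
  the convention \<open>0 powr a = 0\<close>.
\<close>

lemma inner_gradient_lp_objective:
  assumes "2 \<le> p"
  shows "inner_n n y (gradient n (lp_objective n p xs) x) =
    lp_norm n p (x - xs) powr (2 - p) *
      (\<Sum>i<n. y i * (sgn (x i - xs i) * \<bar>x i - xs i\<bar> powr (p - 1)))"
  unfolding inner_n_def sum_distrib_left
  by (rule sum.cong) (auto simp: gradient_lp_objective [OF assms])

text \<open>
  Euler's identity for the objective, which is homogeneous of degree two around \<open>xs\<close>.
\<close>

lemma inner_gradient_lp_objective_diff:
  assumes "2 \<le> p"
  shows "inner_n n (x - xs) (gradient n (lp_objective n p xs) x) = (lp_norm n p (x - xs))\<^sup>2"
proof -
  have "a * (sgn a * \<bar>a\<bar> powr (p - 1)) = \<bar>a\<bar> powr p" for a :: real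
    by (cases "a = 0") (auto simp: powr_diff sgn_if)
  then have "inner_n n (x - xs) (gradient n (lp_objective n p xs) x) =
      lp_norm n p (x - xs) powr (2 - p) * lp_norm n p (x - xs) powr p"
    using assms by (simp add: inner_gradient_lp_objective lp_norm_powr_eq_sum)
  also have "\<dots> = (lp_norm n p (x - xs))\<^sup>2"
    using lp_norm_nonneg [of n p "x - xs"]
    by (cases "lp_norm n p (x - xs) = 0") (simp_all add: flip: powr_add powr_numeral)
  finally show ?thesis .
qed

lemma inner_n_scaleR_left: "inner_n n (c *\<^sub>R x) y = c * inner_n n x y"
  by (simp add: inner_n_def sum_distrib_left mult.assoc)

lemma inner_n_diff_left: "inner_n n (x - y) z = inner_n n x z - inner_n n y z"
  by (simp add: inner_n_def sum_subtractf algebra_simps)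

text \<open>
  Half the squared norm is in general not twice differentiable at the minimizer, so a segment that
  meets it is computed directly. There \<open>x - xs = - s h\<close> and \<open>x + h - xs = (1 - s) h\<close> on the first
  \<open>n\<close> coordinates, and after division by \<open>\<parallel>h\<parallel>\<^sub>p\<^sup>2\<close> the claim reads
  \<open>(1 - s)\<^sup>2 / 2 \<le> s\<^sup>2 / 2 - s + (p - 1) / 2\<close>.
\<close>

lemma lp_objective_add_le_through_zero:
  assumes p: "2 \<le> p" and s: "s \<in> {0..1}" and zero: "\<forall>i<n. x i - xs i + s * h i = 0"
  shows "lp_objective n p xs (x + h) \<le> lp_objective n p xs x
    + inner_n n h (gradient n (lp_objective n p xs) x) + (p - 1) / 2 * (lp_norm n p h)\<^sup>2"
proof -
  define N where "N = lp_norm n p h"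
  have cong: "lp_norm n p y = lp_norm n p (c *\<^sub>R h)" if "\<forall>i<n. y i = c * h i" for c y
    using that by (simp add: lp_norm_def)
  have "lp_norm n p (x - xs) = lp_norm n p ((- s) *\<^sub>R h)"
    using zero by (intro cong) (auto simp: algebra_simps add_eq_0_iff)
  then have x: "lp_norm n p (x - xs) = s * N"
    using p s by (simp add: lp_norm_scaleR N_def del: scaleR_minus_left)
  have "lp_norm n p (x + h - xs) = lp_norm n p ((1 - s) *\<^sub>R h)"
    using zero by (intro cong) (fastforce simp: algebra_simps)
  then have xh: "lp_norm n p (x + h - xs) = (1 - s) * N"
    using p s by (simp add: lp_norm_scaleR N_def)
  have grad: "inner_n n h (gradient n (lp_objective n p xs) x) = - s * N\<^sup>2"
  proof (cases "s = 0")
    case True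
    with x have "lp_norm n p (x - xs) = 0" by simp
    with True show ?thesis
      using p by (simp add: inner_gradient_lp_objective)
  next
    case False
    have "(s * N)\<^sup>2 = inner_n n (x - xs) (gradient n (lp_objective n p xs) x)"
      using inner_gradient_lp_objective_diff [OF p] x by simp
    also have "\<dots> = inner_n n ((- s) *\<^sub>R h) (gradient n (lp_objective n p xs) x)"
    proof -
      have "(x - xs) i = ((- s) *\<^sub>R h) i" if "i < n" for i
        using zero that by (auto simp: algebra_simps add_eq_0_iff)
      then show ?thesis
        by (simp add: inner_n_def)
    qed
    also have "\<dots> = - s * inner_n n h (gradient n (lp_objective n p xs) x)"
      by (rule inner_n_scaleR_left)
    finally have "s * (inner_n n h (gradient n (lp_objective n p xs) x) + s * N\<^sup>2) = 0"
      by (simp add: power2_eq_square algebra_simps)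
    then show ?thesis
      using False by simp
  qed
  have "0 \<le> (p - 2) * N\<^sup>2"
    using p by simp
  then show ?thesis
    unfolding lp_objective_def grad x xh N_def [symmetric]
    by (simp add: power2_eq_square field_simps)
qed

text \<open>
  Let \<open>S\<close> be the sum of the \<open>p\<close>-th powers along the segment, and let \<open>p T\<close> and \<open>p (p - 1) Q\<close> be
  its first two derivatives. As \<open>S\<close> is positive, \<open>F0 = S\<^sup>2\<^sup>/\<^sup>p / 2\<close> is twice differentiable. In
  its second derivative the term with \<open>T\<^sup>2\<close> has the sign of \<open>2 / p - 1 < 0\<close> and is dropped; the
  term with \<open>Q\<close> is at most \<open>(p - 1) \<parallel>h\<parallel>\<^sub>p\<^sup>2\<close> by Hoelder's inequality.
\<close>

lemma lp_objective_add_le_off_zero: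
  assumes p: "2 < p" and nz: "\<forall>s\<in>{0..1}. \<exists>i<n. x i - xs i + s * h i \<noteq> 0"
  shows "lp_objective n p xs (x + h) \<le> lp_objective n p xs x
    + inner_n n h (gradient n (lp_objective n p xs) x) + (p - 1) / 2 * (lp_norm n p h)\<^sup>2"
proof -
  define w where "w = (\<lambda>s i. x i - xs i + s * h i)"
  define S where "S = (\<lambda>s. \<Sum>i<n. \<bar>w s i\<bar> powr p)"
  define T where "T = (\<lambda>s. \<Sum>i<n. h i * (sgn (w s i) * \<bar>w s i\<bar> powr (p - 1)))"
  define Q where "Q = (\<lambda>s. \<Sum>i<n. (h i)\<^sup>2 * \<bar>w s i\<bar> powr (p - 2))"
  define F0 where "F0 = (\<lambda>s. 1 / 2 * S s powr (2 / p))"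
  define F1 where "F1 = (\<lambda>s. S s powr (2 / p - 1) * T s)"
  define F2 where "F2 = (\<lambda>s. (2 / p - 1) * S s powr (2 / p - 2) * p * (T s)\<^sup>2
    + (p - 1) * (S s powr (2 / p - 1) * Q s))"
  have dw: "((\<lambda>s. w s i) has_real_derivative h i) (at s)" for s i
    unfolding w_def by (auto intro!: derivative_eq_intros)
  have dS: "(S has_real_derivative p * T s) (at s)" for s
  proof -
    have "((\<lambda>s. \<bar>w s i\<bar> powr p) has_real_derivative
        p * (sgn (w s i) * \<bar>w s i\<bar> powr (p - 1)) * h i) (at s)" for i
      using DERIV_chain2 [OF has_real_derivative_abs_powr [of p 0] dw] p by simp
    from DERIV_sum [of "{..<n}", OF this] show ?thesis
      by (simp add: S_def T_def sum_distrib_left mult_ac)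
  qed
  have dT: "(T has_real_derivative (p - 1) * Q s) (at s)" for s
  proof -
    have "((\<lambda>s. sgn (w s i) * \<bar>w s i\<bar> powr (p - 1)) has_real_derivative
        (p - 1) * \<bar>w s i\<bar> powr (p - 1 - 1) * h i) (at s)" for i
      using p by (intro DERIV_chain2 [OF has_real_derivative_sgn_powr dw]) auto
    from DERIV_sum [of "{..<n}", OF DERIV_cmult [OF this]]
    have "((\<lambda>s. \<Sum>i<n. h i * (sgn (w s i) * \<bar>w s i\<bar> powr (p - 1))) has_real_derivative
        (\<Sum>i<n. h i * ((p - 1) * \<bar>w s i\<bar> powr (p - 1 - 1) * h i))) (at s)" .
    then show ?thesis
      by (simp add: T_def Q_def sum_distrib_left power2_eq_square mult_ac)
  qed
  have pos: "0 < S s" if s: "s \<in> {0..1}" for s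
  proof -
    obtain k where "k < n" "w s k \<noteq> 0"
      using bspec [OF nz s] by (auto simp: w_def)
    then show ?thesis
      unfolding S_def by (intro sum_pos2 [of _ k]) auto
  qed
  have dF0: "(F0 has_real_derivative F1 s) (at s)" if s: "s \<in> {0..1}" for s
    using DERIV_cmult [OF DERIV_fun_powr [OF dS pos [OF s], of "2 / p"], of "1 / 2"] p
    by (simp add: F0_def F1_def mult_ac)
  have dF1: "(F1 has_real_derivative F2 s) (at s)" if s: "s \<in> {0..1}" for s
    using DERIV_mult [OF DERIV_fun_powr [OF dS pos [OF s], of "2 / p - 1"] dT] p
    by (simp add: F1_def F2_def power2_eq_square algebra_simps)
  have "\<exists>t>0. t < 1 \<and> F0 1 =
      (\<Sum>m<2. ([F0, F1, F2] ! m) 0 / fact m * 1 ^ m) + ([F0, F1, F2] ! 2) t / fact 2 * 1 ^ 2"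
    using dF0 dF1 by (intro Maclaurin) (auto simp: less_2_cases_iff)
  then obtain t where t: "0 < t" "t < 1" and taylor: "F0 1 = F0 0 + F1 0 + F2 t / 2"
    by (auto simp: numeral_2_eq_2)
  have S_norm: "S s = lp_norm n p (w s) powr p" for s
    using p by (simp add: S_def lp_norm_powr_eq_sum)
  have "F2 t \<le> (p - 1) * (S t powr (2 / p - 1) * Q t)"
  proof -
    have "(2 / p - 1) * (S t powr (2 / p - 2) * p * (T t)\<^sup>2) \<le> 0"
      using p by (intro mult_nonpos_nonneg) auto
    then show ?thesis
      by (simp add: F2_def mult.assoc)
  qed
  also have "\<dots> \<le> (p - 1) * (lp_norm n p h)\<^sup>2"
  proof -
    have "S t powr (2 / p - 1) * Q t \<le>
        S t powr (2 / p - 1) * (lp_norm n p (w t) powr (p - 2) * (lp_norm n p h)\<^sup>2)"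
      unfolding Q_def by (intro mult_left_mono sum_powr_times_square_le p) simp
    also have "lp_norm n p (w t) powr (p - 2) = S t powr (1 - 2 / p)"
    proof -
      have "p * (1 - 2 / p) = p - 2"
        using p by (simp add: field_simps)
      then show ?thesis
        by (simp only: S_norm powr_powr)
    qed
    also have "S t powr (2 / p - 1) * (S t powr (1 - 2 / p) * (lp_norm n p h)\<^sup>2) =
        (lp_norm n p h)\<^sup>2"
      using pos [of t] t by (simp flip: mult.assoc powr_add)
    finally show ?thesis
      using p by (intro mult_left_mono) auto
  qed
  finally have F2: "F2 t \<le> (p - 1) * (lp_norm n p h)\<^sup>2" .
  have F0: "F0 s = 1 / 2 * (lp_norm n p (w s))\<^sup>2" for s
    using p lp_norm_nonneg [of n p "w s"] by (simp add: F0_def S_norm powr_powr powr_numeral)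
  have "F0 1 = lp_objective n p xs (x + h)"
    unfolding F0 lp_objective_def w_def lp_norm_def by (simp add: algebra_simps)
  moreover have "F0 0 = lp_objective n p xs x"
    unfolding F0 lp_objective_def w_def lp_norm_def by simp
  moreover have "F1 0 = inner_n n h (gradient n (lp_objective n p xs) x)"
  proof -
    have "lp_norm n p (w 0) = lp_norm n p (x - xs)"
      by (simp add: w_def lp_norm_def)
    moreover have "p * (2 / p - 1) = 2 - p"
      using p by (simp add: field_simps)
    ultimately have "S 0 powr (2 / p - 1) = lp_norm n p (x - xs) powr (2 - p)"
      by (simp only: S_norm powr_powr)
    then show ?thesis
      using p by (simp add: F1_def T_def inner_gradient_lp_objective w_def)
  qed
  ultimately show ?thesis
    using taylor F2 by simp
qed

lemma lp_objective_add_eq_2: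
  "lp_objective n 2 xs (x + h) = lp_objective n 2 xs x
    + inner_n n h (gradient n (lp_objective n 2 xs) x) + 1 / 2 * (lp_norm n 2 h)\<^sup>2"
proof -
  have N: "(lp_norm n 2 y)\<^sup>2 = (\<Sum>i<n. (y i)\<^sup>2)" for y
    using lp_norm_powr_eq_sum [of 2 n y] lp_norm_nonneg [of n 2 y] by (simp add: powr_numeral)
  have "inner_n n h (gradient n (lp_objective n 2 xs) x) = (\<Sum>i<n. h i * (x i - xs i))"
  proof (cases "lp_norm n 2 (x - xs) = 0")
    case True
    then show ?thesis
      by (simp add: inner_gradient_lp_objective lp_norm_eq_0_iff)
  next
    case False
    then show ?thesis
      by (simp add: inner_gradient_lp_objective mult_sgn_abs)
  qed
  moreover have "(lp_norm n 2 (x + h - xs))\<^sup>2 =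
      (lp_norm n 2 (x - xs))\<^sup>2 + 2 * (\<Sum>i<n. h i * (x i - xs i)) + (lp_norm n 2 h)\<^sup>2"
    unfolding N sum_distrib_left sum.distrib [symmetric]
    by (intro sum.cong) (auto simp: power2_eq_square algebra_simps)
  ultimately show ?thesis
    by (simp add: lp_objective_def)
qed

lemma lp_objective_smooth:
  assumes "2 \<le> p"
  shows "lp_objective n p xs (x + h) \<le> lp_objective n p xs x
    + inner_n n h (gradient n (lp_objective n p xs) x) + (p - 1) / 2 * (lp_norm n p h)\<^sup>2"
proof (cases "\<exists>s\<in>{0..1}. \<forall>i<n. x i - xs i + s * h i = 0")
  case True
  then show ?thesis
    using lp_objective_add_le_through_zero assms by blast
next
  case False
  show ?thesis
  proof (cases "p = 2")
    case True
    then show ?thesis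
      using lp_objective_add_eq_2 [of n xs x h] by simp
  next
    case False
    with assms \<open>\<not> (\<exists>s\<in>{0..1}. \<forall>i<n. x i - xs i + s * h i = 0)\<close> show ?thesis
      by (intro lp_objective_add_le_off_zero) auto
  qed
qed

section \<open>Linear convergence\<close>

text \<open>
  Moving from \<open>xs\<close> towards another point of \<open>C\<close> by the distance \<open>r\<close> stays inside \<open>C\<close>. Hence the
  contraction factor of the algorithm is nonnegative as soon as \<open>C\<close> has two points.
\<close>

lemma radius_le_diameter:
  assumes "0 < p" "0 < r" "compact C" "y \<in> C" "xs \<in> C" "lp_norm n p (y - xs) \<noteq> 0"
    and ball: "{z \<in> affine hull C. lp_norm n p (z - xs) \<le> r} \<subseteq> C"
  shows "r \<le> lp_diameter n p C"
proof -
  define c where "c = r / lp_norm n p (y - xs)"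
  define z where "z = (1 - c) *\<^sub>R xs + c *\<^sub>R y"
  have "z - xs = c *\<^sub>R (y - xs)"
    by (simp add: z_def algebra_simps)
  then have r: "lp_norm n p (z - xs) = r"
    using assms lp_norm_nonneg [of n p "y - xs"] by (simp add: lp_norm_scaleR c_def)
  have "z \<in> affine hull C"
    unfolding z_def using assms
    by (intro mem_affine affine_affine_hull) (auto intro: hull_inc)
  with ball r have "z \<in> C"
    by auto
  with r assms show ?thesis
    using lp_norm_diff_le_diameter [of p C xs z n] by simp
qed

text \<open>
  The competitor \<open>w = xs - (r / N) (x - xs)\<close> is an affine combination of points of \<open>C\<close> on the
  sphere of radius \<open>r\<close>, hence in \<open>C\<close>, and \<open>x - w\<close> is a multiple of \<open>x - xs\<close>. So Euler's identity
  evaluates its gap exactly.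
\<close>

lemma frank_wolfe_gap_ge:
  assumes p: "2 \<le> p" and "0 < r" "x \<in> C" "xs \<in> C"
    and v: "is_arg_min (\<lambda>u. inner_n n u (gradient n (lp_objective n p xs) x)) (\<lambda>u. u \<in> C) v"
    and ball: "{z \<in> affine hull C. lp_norm n p (z - xs) \<le> r} \<subseteq> C"
  shows "(lp_norm n p (x - xs))\<^sup>2 + r * lp_norm n p (x - xs)
    \<le> inner_n n (x - v) (gradient n (lp_objective n p xs) x)"
proof (cases "lp_norm n p (x - xs) = 0")
  case True
  then show ?thesis
    using p by (simp add: inner_gradient_lp_objective)
next
  case False
  define N where "N = lp_norm n p (x - xs)"
  define g where "g = gradient n (lp_objective n p xs) x"
  \<comment> \<open>written as an affine combination, with coefficients adding up to one\<close>
  define w where "w = (1 + r / N) *\<^sub>R xs + (- (r / N)) *\<^sub>R x"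
  have "0 < N"
    using False lp_norm_nonneg [of n p "x - xs"] by (simp add: N_def)
  have "w - xs = (- (r / N)) *\<^sub>R (x - xs)"
    by (simp add: w_def algebra_simps)
  then have "lp_norm n p (w - xs) = \<bar>- (r / N)\<bar> * N"
    using p by (simp only: lp_norm_scaleR N_def)
  then have "lp_norm n p (w - xs) = r"
    using \<open>0 < r\<close> \<open>0 < N\<close> by simp
  moreover have "w \<in> affine hull C"
    unfolding w_def using assms
    by (intro mem_affine affine_affine_hull) (auto intro: hull_inc)
  ultimately have "w \<in> C"
    using ball by auto
  with v have "inner_n n v g \<le> inner_n n w g"
    by (simp add: is_arg_min_linorder g_def)
  then have "inner_n n (x - w) g \<le> inner_n n (x - v) g"
    by (simp add: inner_n_diff_left)
  also have "x - w = (1 + r / N) *\<^sub>R (x - xs)"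
    by (simp add: w_def algebra_simps)
  also have "inner_n n \<dots> g = (1 + r / N) * N\<^sup>2"
    using p by (simp add: inner_n_scaleR_left inner_gradient_lp_objective_diff g_def N_def)
  also have "\<dots> = N\<^sup>2 + r * N"
    using \<open>0 < N\<close> by (simp add: field_simps power2_eq_square)
  finally show ?thesis
    unfolding N_def g_def .
qed

text \<open>
  With \<open>q = (p - 1) \<parallel>x - v\<parallel>\<^sub>p\<^sup>2\<close>, smoothness gives \<open>N\<^sup>2 - 2 \<gamma> g + \<gamma>\<^sup>2 q\<close> as a bound for the new
  squared distance. For \<open>\<gamma> = g / q\<close> this is \<open>N\<^sup>2 - g\<^sup>2 / q\<close>, and \<open>r N \<le> g\<close> and
  \<open>q \<le> (p - 1) D\<^sup>2\<close> yield the factor. A full step requires \<open>q \<le> g\<close> and makes the bound at most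
  \<open>N\<^sup>2 - g \<le> 0\<close>: it reaches the minimizer.
\<close>

lemma closed_loop_step_contraction:
  assumes p: "2 \<le> p" and r: "0 < r" "r \<le> lp_diameter n p C"
    and C: "C \<subseteq> Rn n" "compact C" "x \<in> C" "xs \<in> C"
    and v: "is_arg_min (\<lambda>u. inner_n n u (gradient n (lp_objective n p xs) x)) (\<lambda>u. u \<in> C) v"
    and ball: "{z \<in> affine hull C. lp_norm n p (z - xs) \<le> r} \<subseteq> C"
    and \<gamma>: "v \<noteq> x \<longrightarrow> \<gamma> = min (inner_n n (x - v) (gradient n (lp_objective n p xs) x) /
      ((p - 1) * (lp_norm n p (x - v))\<^sup>2)) 1"
  shows "(lp_norm n p (x + \<gamma> *\<^sub>R (v - x) - xs))\<^sup>2
    \<le> (1 - r\<^sup>2 / ((p - 1) * (lp_diameter n p C)\<^sup>2)) * (lp_norm n p (x - xs))\<^sup>2"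
proof -
  define D where "D = lp_diameter n p C"
  define N where "N = lp_norm n p (x - xs)"
  define g where "g = inner_n n (x - v) (gradient n (lp_objective n p xs) x)"
  have N: "0 \<le> N"
    by (simp add: N_def lp_norm_nonneg)
  have gap: "N\<^sup>2 + r * N \<le> g"
    using frank_wolfe_gap_ge [OF p \<open>0 < r\<close> \<open>x \<in> C\<close> \<open>xs \<in> C\<close> v ball] by (simp add: N_def g_def)
  have "v \<in> C"
    using v by (simp add: is_arg_min_linorder)
  have "0 < D"
    using r by (simp add: D_def)
  have "r\<^sup>2 \<le> 1 * D\<^sup>2"
    using r by (simp add: D_def power_mono)
  also have "\<dots> \<le> (p - 1) * D\<^sup>2"
    using p by (intro mult_right_mono) auto
  finally have factor: "0 \<le> (1 - r\<^sup>2 / ((p - 1) * D\<^sup>2)) * N\<^sup>2"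
    using p \<open>0 < D\<close> by (intro mult_nonneg_nonneg) (auto simp: divide_le_eq)
  show ?thesis
  proof (cases "v = x")
    case True
    then have "g = 0"
      by (simp add: g_def inner_n_def)
    with gap N r have "N\<^sup>2 \<le> 0"
      using mult_nonneg_nonneg [of r N] by linarith
    then have "N = 0"
      by simp
    with True show ?thesis
      by (simp add: N_def)
  next
    case False
    define q where "q = (p - 1) * (lp_norm n p (x - v))\<^sup>2"
    \<comment> \<open>The norm sees only the first \<open>n\<close> coordinates, but the others vanish on \<open>C\<close>.\<close>
    have "\<exists>i<n. (x - v) i \<noteq> 0"
    proof (rule ccontr)
      assume "\<not> (\<exists>i<n. (x - v) i \<noteq> 0)"
      moreover have "(x - v) i = 0" if "n \<le> i" for i
        using that subsetD [OF C(1) \<open>x \<in> C\<close>] subsetD [OF C(1) \<open>v \<in> C\<close>] by (simp add: Rn_def)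
      ultimately have "x i = v i" for i
        by (cases "i < n") auto
      with False show False
        by (auto simp: fun_eq_iff)
    qed
    then have "0 < lp_norm n p (x - v)"
      using lp_norm_nonneg [of n p "x - v"] lp_norm_eq_0_iff [of n p "x - v"] by force
    then have q: "0 < q"
      using p by (simp add: q_def)
    have "q \<le> (p - 1) * D\<^sup>2"
      unfolding q_def using p C \<open>v \<in> C\<close>
      by (intro mult_left_mono power_mono lp_norm_nonneg)
        (auto simp: D_def intro: lp_norm_diff_le_diameter)
    have \<gamma>: "\<gamma> = min (g / q) 1"
      using \<gamma> False by (simp add: g_def q_def)
    have "(lp_norm n p (\<gamma> *\<^sub>R (v - x)))\<^sup>2 = \<gamma>\<^sup>2 * (lp_norm n p (x - v))\<^sup>2"
      using p by (simp add: lp_norm_scaleR power_mult_distrib lp_norm_minus_commute [of n p v x])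
    moreover have "inner_n n (\<gamma> *\<^sub>R (v - x)) (gradient n (lp_objective n p xs) x) = - \<gamma> * g"
      by (simp add: inner_n_scaleR_left inner_n_diff_left g_def algebra_simps)
    ultimately have "1 / 2 * (lp_norm n p (x + \<gamma> *\<^sub>R (v - x) - xs))\<^sup>2 \<le>
        1 / 2 * N\<^sup>2 + - \<gamma> * g + (p - 1) / 2 * (\<gamma>\<^sup>2 * (lp_norm n p (x - v))\<^sup>2)"
      using lp_objective_smooth [OF p, of n xs x "\<gamma> *\<^sub>R (v - x)"]
      by (simp only: lp_objective_def N_def)
    also have "(p - 1) / 2 * (\<gamma>\<^sup>2 * (lp_norm n p (x - v))\<^sup>2) = \<gamma>\<^sup>2 * q / 2"
      by (simp add: q_def)
    finally have descent:
        "(lp_norm n p (x + \<gamma> *\<^sub>R (v - x) - xs))\<^sup>2 \<le> N\<^sup>2 - 2 * (\<gamma> * g) + \<gamma>\<^sup>2 * q"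
      by linarith
    show ?thesis
    proof (cases "q \<le> g")
      case True
      then have "\<gamma> = 1"
        using \<gamma> q by (simp add: min_def)
      with descent have "(lp_norm n p (x + \<gamma> *\<^sub>R (v - x) - xs))\<^sup>2 \<le> N\<^sup>2 - 2 * g + q"
        by simp
      also have "\<dots> \<le> 0"
        using True gap mult_nonneg_nonneg [of r N] N r by linarith
      finally have "(lp_norm n p (x + \<gamma> *\<^sub>R (v - x) - xs))\<^sup>2 \<le> 0" .
      with factor show ?thesis
        by (simp add: D_def N_def)
    next
      case False
      then have "\<gamma> = g / q"
        using \<gamma> q by (simp add: min_def)
      with descent q have "(lp_norm n p (x + \<gamma> *\<^sub>R (v - x) - xs))\<^sup>2 \<le> N\<^sup>2 - g\<^sup>2 / q"
        by (simp add: power2_eq_square)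
      moreover have "(r * N)\<^sup>2 / ((p - 1) * D\<^sup>2) \<le> g\<^sup>2 / q"
      proof (rule frac_le)
        have "r * N \<le> g"
          using gap zero_le_power2 [of N] by linarith
        then show "(r * N)\<^sup>2 \<le> g\<^sup>2"
          using r N by (intro power_mono) auto
      qed (use q \<open>q \<le> (p - 1) * D\<^sup>2\<close> in auto)
      ultimately show ?thesis
        by (simp add: D_def N_def algebra_simps power_mult_distrib)
    qed
  qed
qed

lemma frank_wolfe_iterate_in:
  assumes "frank_wolfe n f C x v \<gamma>" "convex C"
  shows "x t \<in> C"
proof (induction t)
  case 0
  then show ?case
    using assms by (auto simp: frank_wolfe_def extreme_point_of_def)
next
  case (Suc t)
  have "(1 - \<gamma> t) *\<^sub>R x t + \<gamma> t *\<^sub>R v t \<in> C"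
    using assms Suc by (intro convexD) (auto simp: frank_wolfe_def extreme_point_of_def)
  moreover have "x (Suc t) = (1 - \<gamma> t) *\<^sub>R x t + \<gamma> t *\<^sub>R v t"
    using assms by (simp add: frank_wolfe_def algebra_simps)
  ultimately show ?case
    by (simp only:)
qed

lemma closed_loop_linear_convergence:
  assumes p: "2 \<le> p" and r: "0 < r" "r \<le> lp_diameter n p C"
    and C: "C \<subseteq> Rn n" "compact C" "convex C" "xs \<in> C"
    and ball: "{z \<in> affine hull C. lp_norm n p (z - xs) \<le> r} \<subseteq> C"
    and fw: "frank_wolfe n (lp_objective n p xs) C x v \<gamma>"
    and cl: "closed_loop n p (lp_objective n p xs) x v \<gamma>"
  shows "(lp_norm n p (x t - xs))\<^sup>2
    \<le> exp (- (r\<^sup>2 / ((p - 1) * (lp_diameter n p C)\<^sup>2)) * t) * (lp_norm n p (x 0 - xs))\<^sup>2"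
    (is "_ \<le> exp (- ?\<kappa> * _) * _")
proof (induction t)
  case (Suc t)
  have "(lp_norm n p (x (Suc t) - xs))\<^sup>2 \<le> (1 - ?\<kappa>) * (lp_norm n p (x t - xs))\<^sup>2"
    using closed_loop_step_contraction
        [OF p r C(1,2) frank_wolfe_iterate_in [OF fw C(3)] C(4), of t "v t" "\<gamma> t"]
      fw cl ball by (simp add: frank_wolfe_def closed_loop_def)
  also have "\<dots> \<le> exp (- ?\<kappa>) * (lp_norm n p (x t - xs))\<^sup>2"
    using exp_ge_add_one_self [of "- ?\<kappa>"] by (intro mult_right_mono) auto
  also have "\<dots> \<le> exp (- ?\<kappa>) * (exp (- ?\<kappa> * t) * (lp_norm n p (x 0 - xs))\<^sup>2)"
    by (intro mult_left_mono Suc exp_ge_zero)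
  also have "\<dots> = exp (- ?\<kappa> * Suc t) * (lp_norm n p (x 0 - xs))\<^sup>2"
  proof -
    have "exp (- k * Suc t) = exp (- k) * exp (- k * t)" for k :: real
      by (subst exp_add [symmetric]) (simp add: algebra_simps)
    then show ?thesis
      by (simp only: mult.assoc)
  qed
  finally show ?case .
qed simp

section \<open>Cardinality of the iterates\<close>

lemma fw_cardinality_le:
  assumes "\<And>s. \<gamma> s \<le> 1"
  shows "fw_cardinality x0 v \<gamma> t \<le> Suc t"
proof -
  have "{u. 0 < fw_weight x0 v \<gamma> t u} \<subseteq> insert x0 (v ` {..<t})"
  proof (induction t)
    case (Suc t)
    have "0 < fw_weight x0 v \<gamma> t u" if "0 < (1 - \<gamma> t) * fw_weight x0 v \<gamma> t u" for u
      using that assms [of t] by (simp add: zero_less_mult_iff)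
    with Suc show ?case
      by (auto simp: lessThan_Suc split: if_splits)
  qed (auto split: if_splits)
  then have "fw_cardinality x0 v \<gamma> t \<le> card (insert x0 (v ` {..<t}))"
    unfolding fw_cardinality_def by (intro card_mono) auto
  also have "\<dots> \<le> Suc (card (v ` {..<t}))"
    by (rule card_insert_le_m1) auto
  also have "\<dots> \<le> Suc t"
    using card_image_le [of "{..<t}" v] by simp
  finally show ?thesis .
qed

theorem corollary5p3:
  shows "\<exists>K>0. \<forall>(n::nat) (p::real) (C::(nat \<Rightarrow> real) set) (xs::nat \<Rightarrow> real) (r::real).
    C \<subseteq> Rn n \<and> compact C \<and> convex C \<and> 2 \<le> p \<and> xs \<in> rel_interior C \<and>
    0 < r \<and> {x \<in> affine hull C. lp_norm n p (x - xs) \<le> r} \<subseteq> C \<longrightarrow>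
    (\<exists>\<epsilon>0. 0 < \<epsilon>0 \<and> \<epsilon>0 < 1 \<and>
      (\<forall>x v \<gamma>.
        frank_wolfe n (lp_objective n p xs) C x v \<gamma> \<and>
        closed_loop n p (lp_objective n p xs) x v \<gamma> \<longrightarrow>
        (\<forall>\<epsilon>. 0 < \<epsilon> \<and> \<epsilon> < \<epsilon>0 \<longrightarrow>
          (\<exists>t. x t \<in> C \<and> lp_norm n p (x t - xs) \<le> \<epsilon> \<and>
            real (fw_cardinality (x 0) v \<gamma> t)
              \<le> K * max 1 (p * (lp_diameter n p C / r)\<^sup>2 * ln (1 / \<epsilon>))))))"
  \<comment> \<open>\<open>6 = 4 + 2\<close>: four from the number of steps, two from rounding it up and from the start vertex\<close>
proof (rule exI [of _ 6], intro conjI allI impI)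
  fix n and p r :: real and C and xs :: "nat \<Rightarrow> real"
  assume "C \<subseteq> Rn n \<and> compact C \<and> convex C \<and> 2 \<le> p \<and> xs \<in> rel_interior C \<and>
    0 < r \<and> {x \<in> affine hull C. lp_norm n p (x - xs) \<le> r} \<subseteq> C"
  then have C: "C \<subseteq> Rn n" "compact C" "convex C" "xs \<in> C" and p: "2 \<le> p" and r: "0 < r"
    and ball: "{x \<in> affine hull C. lp_norm n p (x - xs) \<le> r} \<subseteq> C"
    using rel_interior_subset [of C] by blast+
  define D where "D = lp_diameter n p C"
  have diam: "lp_norm n p (y - xs) \<le> D" if "y \<in> C" for y
    using lp_norm_diff_le_diameter [of p C xs y n] that C p by (simp add: D_def)
  have "0 \<le> D"
    using diam [OF \<open>xs \<in> C\<close>] lp_norm_nonneg order_trans by blast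
  show "\<exists>\<epsilon>0. 0 < \<epsilon>0 \<and> \<epsilon>0 < 1 \<and>
      (\<forall>x v \<gamma>.
        frank_wolfe n (lp_objective n p xs) C x v \<gamma> \<and>
        closed_loop n p (lp_objective n p xs) x v \<gamma> \<longrightarrow>
        (\<forall>\<epsilon>. 0 < \<epsilon> \<and> \<epsilon> < \<epsilon>0 \<longrightarrow>
          (\<exists>t. x t \<in> C \<and> lp_norm n p (x t - xs) \<le> \<epsilon> \<and>
            real (fw_cardinality (x 0) v \<gamma> t)
              \<le> 6 * max 1 (p * (lp_diameter n p C / r)\<^sup>2 * ln (1 / \<epsilon>)))))"
    unfolding D_def [symmetric]
    \<comment> \<open>Below this threshold \<open>D \<le> 1 / \<epsilon>\<close>, so the initial distance costs only a constant factor in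
      the logarithm. The summand \<open>2\<close> keeps the threshold below \<open>1\<close>.\<close>
  proof (rule exI [of _ "1 / (2 + D)"], intro conjI allI impI)
    show "0 < 1 / (2 + D)" "1 / (2 + D) < 1"
      using \<open>0 \<le> D\<close> by simp_all
    fix x v \<gamma> and \<epsilon> :: real
    assume "frank_wolfe n (lp_objective n p xs) C x v \<gamma> \<and>
        closed_loop n p (lp_objective n p xs) x v \<gamma>" and "0 < \<epsilon> \<and> \<epsilon> < 1 / (2 + D)"
    then have fw: "frank_wolfe n (lp_objective n p xs) C x v \<gamma>"
      and cl: "closed_loop n p (lp_objective n p xs) x v \<gamma>"
      and "0 < \<epsilon>" "\<epsilon> < 1 / (2 + D)"
      by blast+
    then have \<epsilon>: "0 < \<epsilon>" "\<epsilon> * (2 + D) < 1"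
      using \<open>0 \<le> D\<close> by (simp_all add: pos_less_divide_eq)
    have "0 \<le> \<epsilon> * D"
      using \<epsilon>(1) \<open>0 \<le> D\<close> by simp
    moreover have "2 * \<epsilon> + \<epsilon> * D < 1"
      using \<epsilon>(2) by (simp add: distrib_left mult.commute)
    ultimately have small: "\<epsilon> < 1" "\<epsilon> * D \<le> 1"
      using \<epsilon>(1) by linarith+
    have xC: "x t \<in> C" for t
      using frank_wolfe_iterate_in [OF fw] C by simp
    have card: "fw_cardinality (x 0) v \<gamma> t \<le> Suc t" for t
      using fw by (intro fw_cardinality_le) (simp add: frank_wolfe_def)
    show "\<exists>t. x t \<in> C \<and> lp_norm n p (x t - xs) \<le> \<epsilon> \<and>
      real (fw_cardinality (x 0) v \<gamma> t) \<le> 6 * max 1 (p * (D / r)\<^sup>2 * ln (1 / \<epsilon>))"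
    proof (cases "lp_norm n p (x 0 - xs) = 0")
      case True
      \<comment> \<open>This covers singletons \<open>C\<close>, whose diameter is \<open>0\<close>: the maximum with \<open>1\<close> is then attained by \<open>1\<close>.\<close>
      then have "lp_norm n p (x 0 - xs) \<le> \<epsilon>"
        using \<epsilon>(1) by linarith
      moreover have "real (fw_cardinality (x 0) v \<gamma> 0) \<le> 6 * max 1 (p * (D / r)\<^sup>2 * ln (1 / \<epsilon>))"
        using card [of 0] by linarith
      ultimately show ?thesis
        using xC by blast
    next
      case False
      then have "r \<le> D"
        unfolding D_def using p r C xC ball by (intro radius_le_diameter) auto
      then have "0 < D"
        using r by simp
      define \<kappa> where "\<kappa> = r\<^sup>2 / ((p - 1) * D\<^sup>2)"
      define l where "l = ln (1 / \<epsilon>)"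
      \<comment> \<open>After \<open>t\<close> steps \<open>N\<^sup>2\<close> is at most \<open>\<epsilon>\<^sup>4 D\<^sup>2\<close>; two of the four factors \<open>\<epsilon>\<close> absorb \<open>D\<^sup>2\<close>.\<close>
      define t where "t = nat \<lceil>4 * l / \<kappa>\<rceil>"
      have "0 < \<kappa>"
        using p r \<open>0 < D\<close> by (simp add: \<kappa>_def)
      have "0 < l"
        using \<epsilon>(1) small(1) by (simp add: l_def)
      then have "0 < 4 * l / \<kappa>"
        using \<open>0 < \<kappa>\<close> by simp
      then have t: "4 * l / \<kappa> \<le> t" "t \<le> 4 * l / \<kappa> + 1"
        unfolding t_def by linarith+
      have "(lp_norm n p (x t - xs))\<^sup>2 \<le> exp (- \<kappa> * t) * (lp_norm n p (x 0 - xs))\<^sup>2"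
        using closed_loop_linear_convergence [OF p r _ C ball fw cl, of t] \<open>r \<le> D\<close>
        unfolding D_def \<kappa>_def .
      also have "\<dots> \<le> exp (- 4 * l) * D\<^sup>2"
      proof (intro mult_mono power_mono diam xC lp_norm_nonneg)
        show "exp (- \<kappa> * t) \<le> exp (- 4 * l)"
          using t(1) \<open>0 < \<kappa>\<close> by (simp add: pos_divide_le_eq mult.commute)
      qed auto
      also have "exp (- 4 * l) = \<epsilon> ^ 4"
      proof -
        have "- 4 * l = of_nat 4 * ln \<epsilon>"
          using \<epsilon>(1) by (simp add: l_def ln_div)
        then show ?thesis
          using \<epsilon>(1) by (simp only: exp_of_nat_mult exp_ln)
      qed
      also have "\<epsilon> ^ 4 * D\<^sup>2 = (\<epsilon> * (\<epsilon> * D))\<^sup>2"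
        by (simp add: power_mult_distrib power2_eq_square power4_eq_xxxx)
      also have "\<dots> \<le> (\<epsilon> * 1)\<^sup>2"
        using \<epsilon>(1) small(2) \<open>0 < D\<close> by (intro power_mono mult_left_mono) simp_all
      finally have "lp_norm n p (x t - xs) \<le> \<epsilon>"
        unfolding mult_1_right by (rule power2_le_imp_le) (use \<epsilon>(1) in simp)
      moreover have "real (fw_cardinality (x 0) v \<gamma> t) \<le> 6 * max 1 (p * (D / r)\<^sup>2 * l)"
      proof -
        have "l / \<kappa> = (p - 1) * ((D / r)\<^sup>2 * l)"
          by (simp add: \<kappa>_def power_divide)
        also have "\<dots> \<le> p * ((D / r)\<^sup>2 * l)"
          using \<open>0 < l\<close> by (intro mult_right_mono) auto
        finally have "real (Suc t) \<le> 4 * (p * (D / r)\<^sup>2 * l) + 2"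
          using t(2) by (simp add: mult.assoc)
        with card [of t] show ?thesis
          by linarith
      qed
      ultimately show ?thesis
        unfolding l_def using xC by blast
    qed
  qed
qed simp

end
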